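(* Let $m\ge 0$ be an integer and let $G$ be a $C_4$-free graph on $n$ vertices. Let $c$ be an edge coloring of $G$ with total color degree $\hat d(G)\ge 2mn$. Then $G$ contains a rainbow matching (with respect to $c$) of size $m$.
   Context: All graphs are finite and simple; $C_4$-free means $G$ has no (not necessarily induced) subgraph isomorphic to the cycle on 4 vertices. An edge coloring of $G$ is any assignment $c:E(G)\to[r]$ of colors to edges (not necessarily proper). For a vertex $v$, the color degree $\hat d(v)$ is the number of distinct colors that $c$ assigns to edges incident to $v$. The total color degree of $G$ is $\hat d(G)=\sum_{v\in V(G)}\hat d(v)$. A matching of size $k$ is a set of $k$ pairwise vertex-disjoint edges; it is rainbow if its edges receive pairwise distinct colors. *)

theory Defs
  imports Main "HOL-Library.FuncSet"
begin

definition simple_graph :: "'a set \<Rightarrow> 'a set set \<Rightarrow> bool" where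
  "simple_graph V E \<longleftrightarrow> finite V \<and> (\<forall>e\<in>E. e \<subseteq> V \<and> card e = 2)"

definition subgraph_of :: "'a set \<Rightarrow> 'a set set \<Rightarrow> 'a set \<Rightarrow> 'a set set \<Rightarrow> bool" where
  "subgraph_of W F V E \<longleftrightarrow> simple_graph W F \<and> W \<subseteq> V \<and> F \<subseteq> E"

definition graph_isomorphic :: "'a set \<Rightarrow> 'a set set \<Rightarrow> 'b set \<Rightarrow> 'b set set \<Rightarrow> bool" where
  "graph_isomorphic V E W F \<longleftrightarrow>
     (\<exists>f. bij_betw f V W \<and> (\<forall>u\<in>V. \<forall>v\<in>V. {u, v} \<in> E \<longleftrightarrow> {f u, f v} \<in> F))"

text \<open>The cycle on \<open>k\<close> vertices, for \<open>k \<ge> 3\<close>, has vertex set \<open>{0..<k}\<close>.\<close>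

definition cycle_edges :: "nat \<Rightarrow> nat set set" where
  "cycle_edges k = {{i, (i + 1) mod k} | i. i < k}"

definition C4_free :: "'a set \<Rightarrow> 'a set set \<Rightarrow> bool" where
  "C4_free V E \<longleftrightarrow>
     \<not> (\<exists>W F. subgraph_of W F V E \<and> graph_isomorphic W F {0..<4} (cycle_edges 4))"

text \<open>Colors are \<open>1, \<dots>, r\<close>; only the values of \<open>c\<close> on \<open>E\<close> are meaningful.\<close>

definition edge_coloring :: "'a set set \<Rightarrow> nat \<Rightarrow> ('a set \<Rightarrow> nat) \<Rightarrow> bool" where
  "edge_coloring E r c \<longleftrightarrow> c \<in> E \<rightarrow> {1..r}"

definition color_degree :: "'a set set \<Rightarrow> ('a set \<Rightarrow> nat) \<Rightarrow> 'a \<Rightarrow> nat" where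
  "color_degree E c v = card (c ` {e \<in> E. v \<in> e})"

definition total_color_degree :: "'a set \<Rightarrow> 'a set set \<Rightarrow> ('a set \<Rightarrow> nat) \<Rightarrow> nat" where
  "total_color_degree V E c = (\<Sum>v\<in>V. color_degree E c v)"

definition matching :: "'a set set \<Rightarrow> 'a set set \<Rightarrow> bool" where
  "matching E M \<longleftrightarrow> finite M \<and> M \<subseteq> E \<and> (\<forall>e\<in>M. \<forall>f\<in>M. e \<noteq> f \<longrightarrow> e \<inter> f = {})"

definition rainbow :: "('a set \<Rightarrow> nat) \<Rightarrow> 'a set set \<Rightarrow> bool" where
  "rainbow c M \<longleftrightarrow> inj_on c M"

lemma simple_graph_finite_edges:
  assumes "simple_graph V E"
  shows "finite E"
proof (rule finite_subset)
  show "E \<subseteq> Pow V" using assms unfolding simple_graph_def by blast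
  show "finite (Pow V)" using assms unfolding simple_graph_def by simp
qed

lemma atLeastLessThan_4: "{0..<4::nat} = {0, 1, 2, 3}"
  by auto

lemma cycle_edges_4: "cycle_edges 4 = {{0, 1}, {1, 2}, {2, 3}, {3, 0}}"
proof -
  have "cycle_edges 4 = (\<lambda>i. {i, (i + 1) mod 4}) ` {0..<4}"
    unfolding cycle_edges_def by auto
  moreover have "(0 + 1) mod 4 = (1::nat)" "(1 + 1) mod 4 = (2::nat)"
    "(2 + 1) mod 4 = (3::nat)" "(3 + 1) mod 4 = (0::nat)"
    by simp_all
  ultimately show ?thesis unfolding atLeastLessThan_4 by (simp only: image_insert image_empty)
qed

lemma simple_graph_C4: "simple_graph {0..<4} (cycle_edges 4)"
  unfolding simple_graph_def cycle_edges_4 by simp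

lemma C4_free_iff:
  assumes "simple_graph V E"
  shows "C4_free V E \<longleftrightarrow>
    \<not> (\<exists>a b c d. distinct [a, b, c, d] \<and> {a, b} \<in> E \<and> {b, c} \<in> E \<and> {c, d} \<in> E \<and> {d, a} \<in> E)"
    (is "_ \<longleftrightarrow> \<not> ?Q")
proof -
  have "?Q" if sub: "subgraph_of W F V E"
    and iso: "graph_isomorphic W F {0..<4} (cycle_edges 4)" for W F
  proof -
    obtain f where bij: "bij_betw f W {0..<4}"
      and f: "\<forall>u\<in>W. \<forall>v\<in>W. {u, v} \<in> F \<longleftrightarrow> {f u, f v} \<in> cycle_edges 4"
      using iso unfolding graph_isomorphic_def by (elim exE conjE)
    have ex: "\<exists>x\<in>W. f x = i" if "i < 4" for i
    proof -
      have "i \<in> f ` W" using bij that unfolding bij_betw_def by simp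
      then show ?thesis by blast
    qed
    obtain a where a: "a \<in> W" "f a = 0" using ex[of 0] by auto
    obtain b where b: "b \<in> W" "f b = 1" using ex[of 1] by auto
    obtain c where c: "c \<in> W" "f c = 2" using ex[of 2] by auto
    obtain d where d: "d \<in> W" "f d = 3" using ex[of 3] by auto
    have "distinct [a, b, c, d]" using a b c d by auto
    moreover have "{a, b} \<in> F" "{b, c} \<in> F" "{c, d} \<in> F" "{d, a} \<in> F"
      using f a b c d by (simp_all add: cycle_edges_4)
    moreover have "F \<subseteq> E" using sub unfolding subgraph_of_def by simp
    ultimately show ?Q by blast
  qed
  moreover have "\<exists>W F. subgraph_of W F V E \<and> graph_isomorphic W F {0..<4} (cycle_edges 4)"
    if d: "distinct [a, b, c, d]" and e: "{a, b} \<in> E" "{b, c} \<in> E" "{c, d} \<in> E" "{d, a} \<in> E"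
    for a b c d
  proof (intro exI conjI)
    let ?W = "{a, b, c, d}" and ?F = "{{a, b}, {b, c}, {c, d}, {d, a}}"
    have "{a, b} \<subseteq> V" "{c, d} \<subseteq> V" using assms e unfolding simple_graph_def by blast+
    then show "subgraph_of ?W ?F V E"
      using d e unfolding subgraph_of_def simple_graph_def by (simp add: card_insert_if eq_commute)
    define f where "f x = (if x = a then 0 else if x = b then 1 else if x = c then 2 else 3::nat)" for x
    have fv: "f a = 0" "f b = 1" "f c = 2" "f d = 3" using d by (auto simp: f_def)
    have "bij_betw f ?W {0..<4}"
      unfolding bij_betw_def inj_on_def atLeastLessThan_4 by (simp add: fv)
    moreover have "\<forall>u\<in>?W. \<forall>v\<in>?W. {u, v} \<in> ?F \<longleftrightarrow> {f u, f v} \<in> cycle_edges 4"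
      using d unfolding cycle_edges_4 by (auto simp: fv doubleton_eq_iff)
    ultimately show "graph_isomorphic ?W ?F {0..<4} (cycle_edges 4)"
      unfolding graph_isomorphic_def by blast
  qed
  ultimately show ?thesis unfolding C4_free_def by blast
qed

end

theory Submission
  imports Defs
begin

text \<open>
  Let \<open>M\<close> be a largest rainbow matching, with \<open>k < m\<close> edges covering the set \<open>U\<close> of \<open>2k\<close> vertices.
  By maximality, every edge avoiding \<open>U\<close> has one of the \<open>k\<close> colors of \<open>M\<close>, so a vertex outside \<open>U\<close>
  has color degree at most \<open>k\<close> plus its number of neighbors in \<open>U\<close>. In a \<open>C\<^sub>4\<close>-free graph each pair in
  \<open>U\<close> has at most one common neighbor, whence the numbers of neighbors in \<open>U\<close>, summed over all
  vertices, give at most \<open>n + k(2k - 1)\<close>; this also bounds the sum of the degrees over \<open>U\<close>. The total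
  color degree is therefore at most \<open>k(n - 2k) + 2(n + k(2k - 1)) = (k + 2)n + 2k\<^sup>2 - 2k\<close>, which is
  less than \<open>2(k + 1)n\<close> if \<open>k \<ge> 1\<close>, as \<open>n \<ge> 2k\<close>. If \<open>k = 0\<close>, there are no edges at all.
\<close>

definition nbrs_in :: "'a set set \<Rightarrow> 'a set \<Rightarrow> 'a \<Rightarrow> 'a set" where
  "nbrs_in E A v = {a \<in> A. {v, a} \<in> E}"

lemma finite_nbrs_in [simp]: "finite A \<Longrightarrow> finite (nbrs_in E A v)"
  by (simp add: nbrs_in_def)

lemma edge_through_vertex:
  assumes "simple_graph V E" "e \<in> E" "v \<in> e"
  obtains w where "e = {v, w}" "w \<in> V" "w \<noteq> v"
proof -
  have "card e = 2" "e \<subseteq> V" using assms unfolding simple_graph_def by auto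
  then obtain x y where "e = {x, y}" "x \<noteq> y" by (auto simp: card_2_iff)
  then show thesis using that[of x] that[of y] \<open>v \<in> e\<close> \<open>e \<subseteq> V\<close> by (auto simp: insert_commute)
qed

text \<open>Double counting: both sides count the pairs \<open>(a, b)\<close> in \<open>A\<close>
  \<times> \<open>B\<close> with \<open>{a, b}\<close> in \<open>E\<close>. Writing cardinalities as
  sums of 0/1 indicators reduces this to exchanging two finite sums.\<close>

lemma sum_card_nbrs_in_swap:
  assumes "finite A" "finite B"
  shows "(\<Sum>a\<in>A. card (nbrs_in E B a)) = (\<Sum>b\<in>B. card (nbrs_in E A b))"
proof -
  have card: "card (nbrs_in E S v) = (\<Sum>s\<in>S. of_bool ({v, s} \<in> E))" if "finite S" for S v
    using that by (simp add: nbrs_in_def sum.If_cases of_bool_def Int_def)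
  show ?thesis
    using sum.swap[of "\<lambda>a b. of_bool ({a, b} \<in> E) :: nat" B A] assms
    by (simp add: card insert_commute)
qed

text \<open>Otherwise \<open>x\<close>, \<open>b\<close>, \<open>y\<close>, \<open>b'\<close> would
  be the successive vertices of a 4-cycle.\<close>

lemma C4_free_common_nbrs:
  assumes "simple_graph V E" "C4_free V E" "x \<noteq> y" "b \<noteq> b'"
    and "x \<in> nbrs_in E A b" "y \<in> nbrs_in E A b" "x \<in> nbrs_in E A b'" "y \<in> nbrs_in E A b'"
  shows False
proof -
  have e: "{b, x} \<in> E" "{b, y} \<in> E" "{b', x} \<in> E" "{b', y} \<in> E"
    using assms by (auto simp: nbrs_in_def)
  have ne: "u \<noteq> v" if "{u, v} \<in> E" for u v
    using that assms(1) by (auto simp: simple_graph_def)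
  have "distinct [x, b, y, b']" using assms(3,4) e[THEN ne] by auto
  moreover have "{x, b} \<in> E" "{b, y} \<in> E" "{y, b'} \<in> E" "{b', x} \<in> E"
    using e by (simp_all add: insert_commute)
  ultimately show False using C4_free_iff[OF assms(1)] assms(2) by blast
qed

text \<open>Since d \<le> 1 + (d choose 2), it suffices to count the pairs inside the sets
  \<open>nbrs_in E A b\<close>. No pair occurs for two different \<open>b\<close>, so these are at
  most all the pairs in \<open>A\<close>.\<close>

lemma C4_free_sum_card_nbrs_in:
  assumes "simple_graph V E" "C4_free V E" "finite A" "finite B"
  shows "(\<Sum>b\<in>B. card (nbrs_in E A b)) \<le> card B + (card A choose 2)"
proof -
  define pairs where "pairs S = {P. P \<subseteq> S \<and> card P = 2}" for S :: "'a set"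
  have card_pairs: "card (pairs S) = card S choose 2" if "finite S" for S
    using n_subsets[OF that] by (simp add: pairs_def)
  have fin: "finite (pairs S)" if "finite S" for S
    using that by (simp add: pairs_def)
  have disj: "pairs (nbrs_in E A b) \<inter> pairs (nbrs_in E A b') = {}" if "b \<noteq> b'" for b b'
    using C4_free_common_nbrs[OF assms(1,2) _ that]
    by (auto simp: pairs_def card_2_iff)
  have "(\<Sum>b\<in>B. card (nbrs_in E A b)) \<le> (\<Sum>b\<in>B. 1 + (card (nbrs_in E A b) choose 2))"
  proof (rule sum_mono)
    fix b
    have "d \<le> 1 + (d choose 2)" for d :: nat
      by (induction d) (auto simp: numeral_2_eq_2)
    then show "card (nbrs_in E A b) \<le> 1 + (card (nbrs_in E A b) choose 2)" .
  qed
  also have "\<dots> = card B + (\<Sum>b\<in>B. card (pairs (nbrs_in E A b)))"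
    using assms(3) by (simp add: card_pairs sum_Suc)
  also have "(\<Sum>b\<in>B. card (pairs (nbrs_in E A b))) = card (\<Union>b\<in>B. pairs (nbrs_in E A b))"
    using assms(3,4) disj by (intro card_UN_disjoint[symmetric]) (auto intro: fin)
  also have "\<dots> \<le> card (pairs A)"
    using assms(3) by (intro card_mono fin) (auto simp: pairs_def nbrs_in_def)
  finally show ?thesis using assms(3) by (simp add: card_pairs)
qed

text \<open>The other end of an edge at \<open>v\<close> either lies in \<open>U\<close>, and then
  the edge contributes at most one color per neighbor, or lies outside \<open>U\<close>, and then
  \<open>avoid\<close> puts its color in \<open>K\<close>. Removing \<open>v\<close> from the
  intersection lets this apply to \<open>v\<close> in \<open>U\<close> as well.\<close>

lemma color_degree_le:
  assumes "simple_graph V E" "finite U" "finite K"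
    and avoid: "\<And>e. e \<in> E \<Longrightarrow> v \<in> e \<Longrightarrow> e \<inter> U - {v} = {} \<Longrightarrow> c e \<in> K"
  shows "color_degree E c v \<le> card K + card (nbrs_in E U v)"
proof -
  have "c ` {e \<in> E. v \<in> e} \<subseteq> K \<union> (\<lambda>u. c {v, u}) ` nbrs_in E U v"
  proof
    fix y assume "y \<in> c ` {e \<in> E. v \<in> e}"
    then obtain e where e: "e \<in> E" "v \<in> e" "y = c e" by auto
    obtain w where w: "e = {v, w}" "w \<noteq> v"
      using edge_through_vertex[OF assms(1) e(1,2)] by metis
    show "y \<in> K \<union> (\<lambda>u. c {v, u}) ` nbrs_in E U v"
      using avoid[OF e(1,2)] e w by (cases "w \<in> U") (auto simp: nbrs_in_def)
  qed
  then have "color_degree E c v \<le> card (K \<union> (\<lambda>u. c {v, u}) ` nbrs_in E U v)"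
    unfolding color_degree_def using assms(2,3) by (intro card_mono) auto
  also have "\<dots> \<le> card K + card ((\<lambda>u. c {v, u}) ` nbrs_in E U v)"
    by (rule card_Un_le)
  also have "\<dots> \<le> card K + card (nbrs_in E U v)"
    using assms(2) by (simp add: card_image_le)
  finally show ?thesis .
qed

lemma card_Union_matching:
  assumes "simple_graph V E" "matching E M"
  shows "card (\<Union>M) = 2 * card M"
proof -
  have e: "e \<in> M \<Longrightarrow> finite e \<and> card e = 2" for e
    using assms by (auto simp: matching_def simple_graph_def intro: finite_subset)
  have "card (\<Union>M) = sum card M"
    using assms(2) e by (intro card_Union_disjoint) (auto simp: matching_def pairwise_def disjnt_def)
  then show ?thesis using e by simp
qed

lemma maximum_rainbow_matching_exists:
  assumes "finite E"
  obtains M where "matching E M" "rainbow c M"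
    "\<And>M'. matching E M' \<Longrightarrow> rainbow c M' \<Longrightarrow> card M' \<le> card M"
proof -
  have "matching E {} \<and> rainbow c {}" by (simp add: matching_def rainbow_def)
  moreover have "\<forall>M. matching E M \<and> rainbow c M \<longrightarrow> card M < Suc (card E)"
    using assms by (auto simp: matching_def less_Suc_eq_le card_mono)
  ultimately have "\<exists>M. (matching E M \<and> rainbow c M) \<and>
      (\<forall>M'. matching E M' \<and> rainbow c M' \<longrightarrow> card M' \<le> card M)"
    by (rule ex_has_greatest_nat)
  then show thesis using that by blast
qed

text \<open>An edge of a new color disjoint from all of \<open>M\<close> could be added to
  \<open>M\<close>, contradicting maximality.\<close>

lemma color_in_maximum_rainbow_matching:
  assumes "matching E M" "rainbow c M" "e \<in> E" "e \<noteq> {}" "e \<inter> \<Union>M = {}"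
    and max: "\<And>M'. matching E M' \<Longrightarrow> rainbow c M' \<Longrightarrow> card M' \<le> card M"
  shows "c e \<in> c ` M"
proof (rule ccontr)
  assume new: "c e \<notin> c ` M"
  then have "e \<notin> M" by blast
  have "matching E (insert e M)" using assms(1,3,5) by (auto simp: matching_def)
  moreover have "rainbow c (insert e M)" using assms(2) new \<open>e \<notin> M\<close> by (simp add: rainbow_def)
  ultimately have "card (insert e M) \<le> card M" by (rule max)
  then show False using assms(1) \<open>e \<notin> M\<close> by (simp add: matching_def)
qed

lemma total_color_degree_less:
  assumes graph: "simple_graph V E" and C4: "C4_free V E" and "V \<noteq> {}"
    and M: "matching E M" "rainbow c M"
    and max: "\<And>M'. matching E M' \<Longrightarrow> rainbow c M' \<Longrightarrow> card M' \<le> card M"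
  shows "total_color_degree V E c < 2 * (card M + 1) * card V"
proof -
  define k n U where "k = card M" and "n = card V" and "U = \<Union>M"
  have finV: "finite V" and edge: "\<And>e. e \<in> E \<Longrightarrow> e \<subseteq> V"
    using graph by (auto simp: simple_graph_def)
  have UV: "U \<subseteq> V" using M(1) edge by (auto simp: matching_def U_def)
  then have finU: "finite U" using finV finite_subset by blast
  have cardU: "card U = 2 * k" unfolding U_def k_def by (rule card_Union_matching[OF graph M(1)])
  have finM: "finite M" using M(1) by (simp add: matching_def)
  have n: "2 * k \<le> n" "0 < n"
    using card_mono[OF finV UV] cardU finV \<open>V \<noteq> {}\<close> by (auto simp: n_def card_gt_0_iff)
  define s where "s = (\<Sum>v\<in>V. card (nbrs_in E U v))"
  have "color_degree E c v \<le> k + card (nbrs_in E U v)" if "v \<in> V - U" for v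
  proof -
    have "color_degree E c v \<le> card (c ` M) + card (nbrs_in E U v)"
    proof (rule color_degree_le[OF graph finU])
      fix e assume "e \<in> E" "v \<in> e" "e \<inter> U - {v} = {}"
      then show "c e \<in> c ` M"
        using that by (intro color_in_maximum_rainbow_matching[OF M _ _ _ max]) (auto simp: U_def)
    qed (simp add: finM)
    also have "card (c ` M) = k" using M(2) by (simp add: k_def rainbow_def card_image)
    finally show ?thesis .
  qed
  then have "(\<Sum>v\<in>V - U. color_degree E c v) \<le> (\<Sum>v\<in>V - U. k + card (nbrs_in E U v))"
    by (rule sum_mono)
  also have "\<dots> = k * (n - 2 * k) + (\<Sum>v\<in>V - U. card (nbrs_in E U v))"
    using UV finU by (simp add: sum.distrib card_Diff_subset cardU n_def)
  \<comment> \<open>Extending the sum to all of \<open>V\<close> lets the single quantity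
    \<open>s\<close> serve both outside and inside \<open>U\<close>.\<close>
  also have "\<dots> \<le> k * (n - 2 * k) + s"
    using finV by (auto simp: s_def intro: sum_mono2)
  finally have outside: "(\<Sum>v\<in>V - U. color_degree E c v) \<le> k * (n - 2 * k) + s" .
  \<comment> \<open>Taking \<open>V\<close> for \<open>U\<close> and no colors for \<open>K\<close>
    bounds the color degree by the ordinary degree.\<close>
  have "color_degree E c v \<le> card (nbrs_in E V v)" for v
  proof -
    have "False" if "e \<in> E" "v \<in> e" "e \<inter> V - {v} = {}" for e
      using edge_through_vertex[OF graph that(1,2)] that(3) by blast
    then show ?thesis using color_degree_le[OF graph finV, of "{}"] by force
  qed
  then have "(\<Sum>v\<in>U. color_degree E c v) \<le> (\<Sum>v\<in>U. card (nbrs_in E V v))"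
    by (intro sum_mono)
  also have "\<dots> = s" unfolding s_def by (rule sum_card_nbrs_in_swap[OF finU finV])
  finally have inside: "(\<Sum>v\<in>U. color_degree E c v) \<le> s" .
  have "total_color_degree V E c =
      (\<Sum>v\<in>V - U. color_degree E c v) + (\<Sum>v\<in>U. color_degree E c v)"
    unfolding total_color_degree_def by (rule sum.subset_diff[OF UV finV])
  then have total: "total_color_degree V E c \<le> k * (n - 2 * k) + 2 * s"
    using outside inside by simp
  show ?thesis
  proof (cases "k = 0")
    case True
    \<comment> \<open>Here \<open>U\<close> is empty, so the total is 0; strictness comes from
      \<open>0 < n\<close>.\<close>
    then have "s = 0" using finU cardU by (simp add: s_def nbrs_in_def)
    then show ?thesis using total True n by (simp add: k_def n_def)
  next
    case False
    have "s \<le> n + k * (2 * k - 1)"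
      using C4_free_sum_card_nbrs_in[OF graph C4 finU finV]
      by (simp add: s_def n_def cardU choose_two)
    \<comment> \<open>These substitutions remove the truncated subtractions. The right side then
      exceeds the bound on the left by \<open>2 * k + k * i\<close>, which is positive as
      \<open>k\<close> is.\<close>
    moreover obtain i j where "n = 2 * k + i" "k = Suc j"
      using n False by (metis le_Suc_ex not0_implies_Suc)
    ultimately have "k * (n - 2 * k) + 2 * s < 2 * (k + 1) * n"
      by (simp add: algebra_simps)
    then show ?thesis using total by (simp add: k_def n_def)
  qed
qed

theorem theorem2:
  fixes V :: "'a set" and E :: "'a set set"
    and c :: "'a set \<Rightarrow> nat" and m n r :: nat
  assumes "simple_graph V E"
    and "card V = n" and "n \<ge> 1"
    and "C4_free V E"
    and "edge_coloring E r c"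
    and "total_color_degree V E c \<ge> 2 * m * n"
  shows "\<exists>M. matching E M \<and> rainbow c M \<and> card M = m"
proof -
  obtain M where M: "matching E M" "rainbow c M"
    and max: "\<And>M'. matching E M' \<Longrightarrow> rainbow c M' \<Longrightarrow> card M' \<le> card M"
    using maximum_rainbow_matching_exists[OF simple_graph_finite_edges[OF assms(1)], of c] by metis
  have "V \<noteq> {}" using assms(2,3) by auto
  then have "2 * m * n < 2 * (card M + 1) * n"
    using total_color_degree_less[OF assms(1,4) _ M max] assms(2,6) by simp
  \<comment> \<open>A maximum rainbow matching may have more than \<open>m\<close> edges; any
    \<open>m\<close> of them suffice.\<close>
  then have "m \<le> card M" by (simp only: mult_less_cancel2) simp
  then obtain M' where "M' \<subseteq> M" "card M' = m" by (meson obtain_subset_with_card_n)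
  moreover have "matching E M'"
    using M(1) \<open>M' \<subseteq> M\<close> unfolding matching_def by (meson finite_subset subset_iff)
  moreover have "rainbow c M'"
    using M(2) \<open>M' \<subseteq> M\<close> unfolding rainbow_def by (rule inj_on_subset)
  ultimately show ?thesis by blast
qed

end
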